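(* Let $(A_i)_{i\in I}$ be a family of closed convex subsets of $\mathbb R^n$ such that $0\in\bigcap_{i\in I}A_i$, and let $t_i\in\mathbb R$ ($i\in I$) satisfy $\sup_{i\in I}t_i\le 0$. Then for any $\overline{x}^*\in\operatorname{ri}\Big(\bigcup_{J\in\mathcal F(I)}\sum_{j\in J}A_j\Big)$ one has $$\min_{x\in\mathbb R^n}\Big(\sum\nolimits_{i\in I}^{R}(\sigma_{A_i}(x)-t_i)-\langle\overline{x}^*,x\rangle\Big)=\sup\Big\{-\sum_{j\in J}t_j: J\in\mathcal F(I),\ \overline{x}^*\in\sum_{j\in J}A_j\Big\},$$ where writing $\min$ asserts that the infimum over $\mathbb R^n$ is attained.
   Context: $I$ is an infinite index set and $\mathcal F(I)$ is the collection of all nonempty finite subsets of $I$. The robust sum of functions $f_i:\mathbb R^n\to\mathbb R\cup\{+\infty\}$ is $\sum_{i\in I}^R f_i(x):=\sup_{J\in\mathcal F(I)}\sum_{i\in J}f_i(x)$. For $A\subset\mathbb R^n$ nonempty, $\sigma_A(x)=\sup_{a\in A}\langle a,x\rangle$ is the support function. $\operatorname{ri}$ denotes the relative interior. Sums of sets are Minkowski sums. The infimum and supremum are taken in $\overline{\mathbb R}$; attainment means that some $x\in\mathbb R^n$ has objective value equal to the infimum (trivially true if the objective is identically $+\infty$). *)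

theory Defs
  imports "HOL-Analysis.Analysis" "HOL-Library.Set_Algebras"
begin

text \<open>
  Functions with values in \<open>\<real> \<union> {+\<infinity>}\<close> are modelled with the type \<^typ>\<open>ereal\<close>. Sums of sets are
  Minkowski sums, via the additive monoid structure on sets from \<open>HOL-Library.Set_Algebras\<close>.
\<close>

definition nonempty_finite_subsets :: "'i set \<Rightarrow> 'i set set" where
  "nonempty_finite_subsets I = {J. J \<subseteq> I \<and> finite J \<and> J \<noteq> {}}"

definition robust_sum :: "('i \<Rightarrow> 'a \<Rightarrow> ereal) \<Rightarrow> 'i set \<Rightarrow> 'a \<Rightarrow> ereal" where
  "robust_sum f I x = (SUP J\<in>nonempty_finite_subsets I. \<Sum>i\<in>J. f i x)"

definition support_function :: "'a::real_inner set \<Rightarrow> 'a \<Rightarrow> ereal" where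
  "support_function A x = (SUP a\<in>A. ereal (a \<bullet> x))"

end

theory Submission imports Defs
begin

text \<open>
  Write \<open>t\<^sub>J\<close> and \<open>A\<^sub>J\<close> for the sums over \<open>J\<close>. If \<open>xs \<in> A\<^sub>J\<close>, the sum of the support functions over \<open>J\<close>
  dominates \<open>\<langle>xs, x\<rangle>\<close>, so the objective is everywhere at least \<open>- t\<^sub>J\<close>. Conversely, the objective at \<open>0\<close>
  is the supremum of \<open>- t\<^sub>J\<close> over all \<open>J\<close>. Restricting to those \<open>J\<close> with \<open>xs \<in> A\<^sub>J\<close> does not change
  it: since \<open>0 \<in> A\<^sub>i\<close> and \<open>t\<^sub>i \<le> 0\<close>, both \<open>A\<^sub>J\<close> and \<open>- t\<^sub>J\<close> increase with \<open>J\<close>, and \<open>xs\<close> lies in some \<open>A\<^sub>K\<close>.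
  Hence the minimum is attained at \<open>0\<close>.
\<close>

lemma support_function_zero:
  "A \<noteq> {} \<Longrightarrow> support_function A 0 = 0"
  by (simp add: support_function_def zero_ereal_def)

lemma support_function_upper:
  "a \<in> A \<Longrightarrow> ereal (a \<bullet> x) \<le> support_function A x"
  unfolding support_function_def by (rule SUP_upper)

text \<open>Split \<open>y\<close> into summands \<open>a j\<close> from the sets
  \<open>A j\<close>; the inner product is additive, and each term is bounded by its own support
  function.\<close>

lemma inner_le_sum_support_function:
  assumes "finite J" and "y \<in> (\<Sum>j\<in>J. A j)"
  shows "ereal (y \<bullet> x) \<le> (\<Sum>j\<in>J. support_function (A j) x)"
proof -
  obtain a where a: "y = sum a J" "\<forall>j\<in>J. a j \<in> A j"
    using assms by (auto simp: set_sum_alt)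
  have "ereal (y \<bullet> x) = (\<Sum>j\<in>J. ereal (a j \<bullet> x))"
    by (simp add: a(1) inner_sum_left)
  also have "\<dots> \<le> (\<Sum>j\<in>J. support_function (A j) x)"
    by (intro sum_mono support_function_upper) (use a(2) in blast)
  finally show ?thesis .
qed

text \<open>A decomposition over \<open>J\<close> extends to \<open>K\<close> by choosing the
  summand 0 on \<open>K - J\<close>, which leaves the total unchanged.\<close>

lemma minkowski_sum_mono_index:
  fixes A :: "'i \<Rightarrow> 'a::comm_monoid_add set"
  assumes "finite K" and "J \<subseteq> K" and "\<And>i. i \<in> K - J \<Longrightarrow> 0 \<in> A i"
  shows "(\<Sum>j\<in>J. A j) \<subseteq> (\<Sum>j\<in>K. A j)"
proof
  fix y assume "y \<in> (\<Sum>j\<in>J. A j)"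
  moreover have "finite J"
    using assms(1,2) finite_subset by blast
  ultimately obtain a where a: "y = sum a J" "\<forall>j\<in>J. a j \<in> A j"
    by (auto simp: set_sum_alt)
  define b where "b i = (if i \<in> J then a i else 0)" for i
  have "y = sum b K"
    unfolding a(1) b_def
    by (rule sum.mono_neutral_cong_left) (use assms in auto)
  moreover have "\<forall>i\<in>K. b i \<in> A i"
    using a(2) assms(3) by (auto simp: b_def)
  ultimately show "y \<in> (\<Sum>j\<in>K. A j)"
    using assms(1) by (auto simp: set_sum_alt)
qed

theorem proposition5p3:
  fixes I :: "'i set"
    and A :: "'i \<Rightarrow> (real ^ 'n) set"
    and t :: "'i \<Rightarrow> real"
    and xs :: "real ^ 'n"
  defines "obj \<equiv> \<lambda>x::real ^ 'n.
      robust_sum (\<lambda>i x. support_function (A i) x - ereal (t i)) I x - ereal (xs \<bullet> x)"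
  assumes "infinite I"
    and "\<And>i. i \<in> I \<Longrightarrow> closed (A i)"
    and "\<And>i. i \<in> I \<Longrightarrow> convex (A i)"
    and "0 \<in> (\<Inter>i\<in>I. A i)"
    and "(SUP i\<in>I. ereal (t i)) \<le> 0"
    and "xs \<in> rel_interior (\<Union>J\<in>nonempty_finite_subsets I. \<Sum>j\<in>J. A j)"
  shows "(INF x. obj x) =
           Sup {ereal (- (\<Sum>j\<in>J. t j)) | J. J \<in> nonempty_finite_subsets I \<and> xs \<in> (\<Sum>j\<in>J. A j)}
         \<and> (\<exists>x. obj x = (INF y. obj y))"
proof -
  let ?F = "nonempty_finite_subsets I"
  let ?R = "Sup {ereal (- (\<Sum>j\<in>J. t j)) | J. J \<in> ?F \<and> xs \<in> (\<Sum>j\<in>J. A j)}"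
  have zero: "0 \<in> A i" if "i \<in> I" for i
    using assms(5) that by blast
  have t_nonpos: "t i \<le> 0" if "i \<in> I" for i
    using assms(6) that by (auto simp: SUP_le_iff)
  obtain K where K: "K \<in> ?F" "xs \<in> (\<Sum>j\<in>K. A j)"
    using assms(7) rel_interior_subset by blast

  have lower: "?R \<le> obj x" for x
  proof (rule Sup_least)
    fix r assume "r \<in> {ereal (- (\<Sum>j\<in>J. t j)) | J. J \<in> ?F \<and> xs \<in> (\<Sum>j\<in>J. A j)}"
    then obtain J where J: "r = ereal (- (\<Sum>j\<in>J. t j))" "J \<in> ?F" "xs \<in> (\<Sum>j\<in>J. A j)"
      by blast
    have "finite J"
      using J(2) by (simp add: nonempty_finite_subsets_def)
    \<comment> \<open>The finite term \<open>xs \<bullet> x\<close> is added on the left, not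
      subtracted on the right, because the support functions may be infinite;
      \<open>ereal_le_minus\<close> moves it back at the end.\<close>
    have "r + ereal (xs \<bullet> x) \<le> (\<Sum>j\<in>J. support_function (A j) x) + (\<Sum>j\<in>J. ereal (- t j))"
      using add_mono[OF inner_le_sum_support_function[OF \<open>finite J\<close> J(3), of x]
          order_refl[of "\<Sum>j\<in>J. ereal (- t j)"]]
      by (simp add: J(1) sum_negf add.commute)
    also have "\<dots> = (\<Sum>j\<in>J. support_function (A j) x - ereal (t j))"
      by (simp add: sum.distrib minus_ereal_def del: sum_ereal)
    also have "\<dots> \<le> robust_sum (\<lambda>i x. support_function (A i) x - ereal (t i)) I x"
      unfolding robust_sum_def using J(2) by (rule SUP_upper)
    finally show "r \<le> obj x"
      unfolding obj_def by (simp add: ereal_le_minus)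
  qed

  have "(\<Sum>j\<in>J. support_function (A j) 0 - ereal (t j)) \<le> ?R" if "J \<in> ?F" for J
  proof -
    \<comment> \<open>\<open>J\<close> alone need not satisfy the membership condition in
      \<open>?R\<close>. Adjoining \<open>K\<close> ensures it and can only increase the sum of the
      terms \<open>- t j\<close>.\<close>
    have JK: "J \<union> K \<in> ?F" and fin: "finite (J \<union> K)" and sub: "J \<union> K \<subseteq> I"
      using that K(1) by (auto simp: nonempty_finite_subsets_def)
    have "(\<Sum>j\<in>J. support_function (A j) 0 - ereal (t j)) = (\<Sum>j\<in>J. ereal (- t j))"
      using sub zero by (intro sum.cong refl) (subst support_function_zero; fastforce)
    also have "\<dots> = ereal (\<Sum>j\<in>J. - t j)"
      by simp
    also have "\<dots> \<le> ereal (\<Sum>j\<in>J \<union> K. - t j)"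
      unfolding ereal_less_eq using fin sub t_nonpos by (intro sum_mono2) auto
    also have "\<dots> \<le> ?R"
    proof (rule Sup_upper)
      have "xs \<in> (\<Sum>j\<in>J \<union> K. A j)"
        using minkowski_sum_mono_index[OF fin, of K A] K(2) sub zero by blast
      then show "ereal (\<Sum>j\<in>J \<union> K. - t j) \<in>
          {ereal (- (\<Sum>j\<in>J. t j)) | J. J \<in> ?F \<and> xs \<in> (\<Sum>j\<in>J. A j)}"
        using JK by (auto simp: sum_negf)
    qed
    finally show ?thesis .
  qed
  then have "obj 0 \<le> ?R"
    unfolding obj_def robust_sum_def by (simp add: SUP_le_iff zero_ereal_def[symmetric])
  then have eq: "obj 0 = ?R"
    using lower by (rule antisym)
  have "(INF x. obj x) = ?R"
    using lower eq by (metis INF_greatest INF_lower UNIV_I antisym)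
  with eq show ?thesis
    by metis
qed

end
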